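(* Let $k$ be a natural number and let $m\le\left\lfloor\frac k2\right\rfloor$ be a natural number ($m\ge1$). Define the $m$-th degree polynomial $Q_m(x)=\prod_{j=1}^m\left(x-4\sin^2\left(\frac{j\pi}k\right)\right)=\sum_{j=0}^mc_{m,j}x^j$. Suppose $z=(z_0,\dots,z_{k-1})\in\mathbb C^k$ satisfies $\sum_{\nu=0}^{k-1}z_\nu=0$. Then $$\sum_{j=0}^mc_{m,j}\left\|z^{(j)}\right\|^2\ge0 .$$ Equality holds if and only if the Fourier coefficients of $z$ satisfy $\zeta_\nu=0$ for $m<\nu<k-m$.
   Context: $\|\cdot\|$ is the norm of the Hermitian inner product $\langle z,w\rangle=\sum_{\nu=0}^{k-1}z_\nu\overline{w_\nu}$ on $\mathbb C^k$. The derivative (first difference) of $z$ is $\dot z=(z_1-z_0,z_2-z_1,\dots,z_0-z_{k-1})$, and $z^{(j)}$ is its $j$-fold iterate ($z^{(0)}=z$). The Fourier coefficients are $\zeta_\nu=\frac1k\sum_{j=0}^{k-1}z_j\,e^{-2\pi i\nu j/k}$, $0\le\nu\le k-1$. *)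

theory Defs
  imports Complex_Main "HOL-Computational_Algebra.Polynomial"
begin

text \<open>
  A vector \<open>(z\<^sub>0, \<dots>, z\<^sub>k\<^sub>-\<^sub>1)\<close> in complex \<open>k\<close>-space is represented by a function
  \<open>z :: nat \<Rightarrow> complex\<close> of which only the values at indices below \<open>k\<close> are relevant.
  The norm and the Fourier coefficients do not depend on the other values, nor do the
  components of the cyclic difference at indices below \<open>k\<close>.
\<close>

definition herm_inner :: "nat \<Rightarrow> (nat \<Rightarrow> complex) \<Rightarrow> (nat \<Rightarrow> complex) \<Rightarrow> complex" where
  "herm_inner k z w = (\<Sum>\<nu><k. z \<nu> * cnj (w \<nu>))"

definition herm_norm :: "nat \<Rightarrow> (nat \<Rightarrow> complex) \<Rightarrow> real" where
  "herm_norm k z = sqrt (Re (herm_inner k z z))"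

text \<open>
  The cyclic first difference; the last component (index \<open>k - 1\<close>) is \<open>z\<^sub>0 - z\<^sub>k\<^sub>-\<^sub>1\<close>.
  The \<open>j\<close>-th derivative of \<open>z\<close> is \<open>(cyc_diff k ^^ j) z\<close>.
\<close>

definition cyc_diff :: "nat \<Rightarrow> (nat \<Rightarrow> complex) \<Rightarrow> (nat \<Rightarrow> complex)" where
  "cyc_diff k z = (\<lambda>\<nu>. z ((\<nu> + 1) mod k) - z \<nu>)"

definition fourier_coeff :: "nat \<Rightarrow> (nat \<Rightarrow> complex) \<Rightarrow> nat \<Rightarrow> complex" where
  "fourier_coeff k z \<nu> =
     1 / of_nat k * (\<Sum>j<k. z j * exp (- 2 * of_real pi * \<i> * of_nat \<nu> * of_nat j / of_nat k))"

definition Q_poly :: "nat \<Rightarrow> nat \<Rightarrow> real poly" where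
  "Q_poly k m = (\<Prod>j=1..m. [:- (4 * (sin (real j * pi / real k))\<^sup>2), 1:])"

lemma poly_Q_poly:
  "poly (Q_poly k m) x = (\<Prod>j=1..m. (x - 4 * (sin (real j * pi / real k))\<^sup>2))"
  by (simp add: Q_poly_def poly_prod)

end

theory Submission
  imports Defs
begin

text \<open>
  The discrete Fourier transform diagonalises the cyclic difference: it multiplies the
  \<open>\<nu>\<close>-th Fourier coefficient by \<open>e\<^bsup>2\<pi>i\<nu>/k\<^esup> - 1\<close>
  (lemma \<open>fourier_coeff_cyc_diff\<close>), whose squared modulus is
  \<open>\<lambda>\<^sub>\<nu> = 4 sin\<^sup>2(\<nu>\<pi>/k)\<close>.  By Parseval's identity (lemma \<open>parseval\<close>), a linear
  combination of the \<open>\<parallel>z\<^sup>(\<^sup>j\<^sup>)\<parallel>\<^sup>2\<close> with the coefficients of a polynomial \<open>p\<close> is therefore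
  the quadratic form \<open>k \<Sum>\<^sub>\<nu> p(\<lambda>\<^sub>\<nu>) |\<zeta>\<^sub>\<nu>|\<^sup>2\<close> (lemma \<open>sum_coeff_mult_norm_derivatives\<close>).

  For \<open>p = Q\<^sub>m\<close> every term is nonnegative.  The factors of \<open>Q\<^sub>m(\<lambda>\<^sub>\<nu>)\<close> are
  \<open>\<lambda>\<^sub>\<nu> - \<lambda>\<^sub>j = 4 sin((\<nu>+j)\<pi>/k) sin((\<nu>-j)\<pi>/k)\<close> with \<open>1 \<le> j \<le> m\<close>.
  If \<open>m < \<nu> < k - m\<close>, both angles lie strictly between \<open>0\<close> and \<open>\<pi>\<close>, so
  \<open>Q\<^sub>m(\<lambda>\<^sub>\<nu>) > 0\<close>.  For the other indices \<open>\<nu> \<noteq> 0\<close> the factor with \<open>j = \<nu>\<close> or with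
  \<open>j = k - \<nu>\<close> vanishes.  For \<open>\<nu> = 0\<close> the value \<open>Q\<^sub>m(0)\<close> may be negative, but
  \<open>\<zeta>\<^sub>0\<close> is the mean of \<open>z\<close>, which is zero.  So the form is a combination, with
  strictly positive weights, of the \<open>|\<zeta>\<^sub>\<nu>|\<^sup>2\<close> with \<open>m < \<nu> < k - m\<close>, and it vanishes
  exactly when these do.
\<close>

lemma herm_norm_power2: "(herm_norm k z)\<^sup>2 = (\<Sum>\<nu><k. (cmod (z \<nu>))\<^sup>2)"
proof -
  have "Re (herm_inner k z z) = (\<Sum>\<nu><k. (cmod (z \<nu>))\<^sup>2)"
    by (simp add: herm_inner_def complex_mult_cnj cmod_power2)
  then show ?thesis
    by (simp add: herm_norm_def sum_nonneg)
qed

lemma norm_cis_minus_one_power2: "(cmod (cis t - 1))\<^sup>2 = 4 * (sin (t / 2))\<^sup>2"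
proof -
  have "(cmod (cis t - 1))\<^sup>2 = 2 - 2 * cos t"
    using sin_cos_squared_add[of t] by (simp add: cmod_power2 power2_diff)
  also have "cos t = 1 - 2 * (sin (t / 2))\<^sup>2"
    using cos_double_sin[of "t / 2"] by simp
  finally show ?thesis by simp
qed

lemma sin_power2_diff: "(sin a)\<^sup>2 - (sin b)\<^sup>2 = sin (a + b) * sin (a - b)" for a b :: real
proof -
  have "sin (a + b) * sin (a - b) = (sin a)\<^sup>2 * (cos b)\<^sup>2 - (cos a)\<^sup>2 * (sin b)\<^sup>2"
    by (simp add: sin_add sin_diff algebra_simps power2_eq_square)
  then show ?thesis
    by (simp add: cos_squared_eq algebra_simps)
qed

lemma sin_pi_fraction_pos:
  fixes n k :: nat
  assumes "0 < n" "n < k"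
  shows "0 < sin (real n * pi / real k)"
  using assms by (intro sin_gt_zero) (simp_all add: field_simps)

text \<open>
  With the exponentials written as powers of one root of unity, the index shift in the
  transform of \<open>cyc_diff k z\<close> and the orthogonality relations become polynomial algebra
  in that root.
\<close>
lemma fourier_coeff_power:
  "fourier_coeff k z \<nu> = (\<Sum>j<k. z j * cis (- (2 * pi * real \<nu> / real k)) ^ j) / of_nat k"
proof -
  have "exp (- 2 * of_real pi * \<i> * of_nat \<nu> * of_nat j / of_nat k)
      = cis (- (2 * pi * real \<nu> / real k)) ^ j" for j
    by (subst Complex.DeMoivre) (simp add: cis_conv_exp mult_ac)
  then show ?thesis
    by (simp add: fourier_coeff_def)
qed

lemma sum_cis_orthogonal:
  assumes "j < k" "l < k"
  shows "(\<Sum>\<nu><k. cis (2 * pi * (real l - real j) / real k) ^ \<nu>) = (if j = l then of_nat k else 0)"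
proof (cases "j = l")
  case True
  then show ?thesis by simp
next
  case False
  define q where "q = cis (2 * pi * (real l - real j) / real k)"
  have "k > 0" using assms by simp
  have "q ^ k = cis (2 * pi * of_int (int l - int j))"
    using \<open>k > 0\<close> by (simp add: q_def Complex.DeMoivre)
  then have "q ^ k = 1"
    by (simp only: cis_multiple_2pi Ints_of_int)
  \<comment> \<open>The distance from \<open>q\<close> to \<open>1\<close> is a sine, nonzero because \<open>0 < \<bar>l - j\<bar> < k\<close>.\<close>
  have "2 * pi * (real l - real j) / real k / 2 = (real l - real j) * pi / real k"
    by simp
  then have "(cmod (q - 1))\<^sup>2 = 4 * (sin ((real l - real j) * pi / real k))\<^sup>2"
    by (simp only: q_def norm_cis_minus_one_power2)
  moreover have "sin ((real l - real j) * pi / real k) \<noteq> 0"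
  proof (cases "j < l")
    case True
    then show ?thesis
      using sin_pi_fraction_pos[of "l - j" k] assms by (simp add: of_nat_diff less_imp_diff_less)
  next
    case False
    then have "0 < sin ((real j - real l) * pi / real k)"
      using sin_pi_fraction_pos[of "j - l" k] assms \<open>j \<noteq> l\<close> by (simp add: of_nat_diff)
    also have "(real j - real l) * pi / real k = - ((real l - real j) * pi / real k)"
      by (simp add: left_diff_distrib diff_divide_distrib)
    finally show ?thesis by simp
  qed
  ultimately have "q \<noteq> 1" by auto
  then show ?thesis
    using \<open>q ^ k = 1\<close> False by (simp add: geometric_sum flip: q_def)
qed

lemma parseval:
  assumes "k > 0"
  shows "(herm_norm k z)\<^sup>2 = real k * (\<Sum>\<nu><k. (cmod (fourier_coeff k z \<nu>))\<^sup>2)"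
proof -
  define e where "e \<nu> = cis (- (2 * pi * real \<nu> / real k))" for \<nu> :: nat
  have e: "e \<nu> ^ j * cnj (e \<nu> ^ l) = cis (2 * pi * (real l - real j) / real k) ^ \<nu>" for \<nu> j l
    by (simp add: e_def Complex.DeMoivre cis_mult cis_cnj)
      (simp add: right_diff_distrib diff_divide_distrib mult_ac)
  have "(\<Sum>\<nu><k. (\<Sum>j<k. z j * e \<nu> ^ j) * cnj (\<Sum>j<k. z j * e \<nu> ^ j))
      = (\<Sum>\<nu><k. \<Sum>j<k. \<Sum>l<k. z j * cnj (z l) * (e \<nu> ^ j * cnj (e \<nu> ^ l)))"
    by (simp add: sum_product mult_ac)
  also have "\<dots> = (\<Sum>j<k. \<Sum>l<k. \<Sum>\<nu><k. z j * cnj (z l) * (e \<nu> ^ j * cnj (e \<nu> ^ l)))"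
    by (subst sum.swap, intro sum.cong refl sum.swap)
  also have "\<dots> = (\<Sum>j<k. \<Sum>l<k. if j = l then z j * cnj (z l) * of_nat k else 0)"
    unfolding e sum_distrib_left[symmetric]
    by (intro sum.cong refl) (simp add: sum_cis_orthogonal)
  also have "\<dots> = of_real (real k * (herm_norm k z)\<^sup>2)"
    by (simp add: herm_norm_power2 sum_distrib_left complex_norm_square mult_ac flip: of_real_power)
  finally have "of_real (\<Sum>\<nu><k. (cmod (\<Sum>j<k. z j * e \<nu> ^ j))\<^sup>2)
      = (of_real (real k * (herm_norm k z)\<^sup>2) :: complex)"
    by (simp only: of_real_sum complex_norm_square)
  then have "(\<Sum>\<nu><k. (cmod (\<Sum>j<k. z j * e \<nu> ^ j))\<^sup>2) = real k * (herm_norm k z)\<^sup>2"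
    by (simp only: of_real_eq_iff)
  moreover have "(\<Sum>\<nu><k. (cmod (fourier_coeff k z \<nu>))\<^sup>2)
      = (\<Sum>\<nu><k. (cmod (\<Sum>j<k. z j * e \<nu> ^ j))\<^sup>2) / (real k)\<^sup>2"
    by (simp add: fourier_coeff_power norm_divide power_divide flip: e_def sum_divide_distrib)
  ultimately show ?thesis
    using assms by (simp add: power2_eq_square)
qed

lemma fourier_coeff_cyc_diff:
  assumes "k > 0"
  shows "fourier_coeff k (cyc_diff k z) \<nu> = (cis (2 * pi * real \<nu> / real k) - 1) * fourier_coeff k z \<nu>"
proof -
  define x where "x = cis (- (2 * pi * real \<nu> / real k))"
  obtain n where k: "k = Suc n" using assms gr0_implies_Suc by blast
  have "x ^ k = cis (2 * pi * of_int (- int \<nu>))"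
    using assms by (simp add: x_def Complex.DeMoivre)
  then have "x ^ k = 1"
    by (simp only: cis_multiple_2pi Ints_of_int)
  \<comment> \<open>Multiplication by \<open>x\<close> shifts the sum by one index; the entry \<open>z\<^sub>0\<close> that wraps around
    carries the factor \<open>x\<^sup>k = 1\<close>.\<close>
  have "x * (\<Sum>j<k. z ((j + 1) mod k) * x ^ j) = (\<Sum>j<Suc n. z (Suc j mod Suc n) * x ^ Suc j)"
    by (simp add: k sum_distrib_left mult_ac del: sum.lessThan_Suc)
  also have "\<dots> = (\<Sum>j<n. z (Suc j) * x ^ Suc j) + z 0"
    using \<open>x ^ k = 1\<close> by (simp add: k)
  also have "\<dots> = (\<Sum>j<k. z j * x ^ j)"
    unfolding k by (subst sum.lessThan_Suc_shift) simp
  finally have shift: "x * (\<Sum>j<k. z ((j + 1) mod k) * x ^ j) = (\<Sum>j<k. z j * x ^ j)" .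
  have "cis (2 * pi * real \<nu> / real k) * x = 1"
    by (simp add: x_def cis_mult)
  then have "(\<Sum>j<k. z ((j + 1) mod k) * x ^ j)
      = cis (2 * pi * real \<nu> / real k) * (\<Sum>j<k. z j * x ^ j)"
    unfolding shift[symmetric] mult.assoc[symmetric] by simp
  then have "(\<Sum>j<k. cyc_diff k z j * x ^ j)
      = (cis (2 * pi * real \<nu> / real k) - 1) * (\<Sum>j<k. z j * x ^ j)"
    by (simp add: cyc_diff_def left_diff_distrib sum_subtractf)
  then show ?thesis
    by (simp add: fourier_coeff_power flip: x_def)
qed

lemma norm_fourier_coeff_derivative:
  assumes "k > 0"
  shows "(cmod (fourier_coeff k ((cyc_diff k ^^ j) z) \<nu>))\<^sup>2
    = (4 * (sin (real \<nu> * pi / real k))\<^sup>2) ^ j * (cmod (fourier_coeff k z \<nu>))\<^sup>2"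
proof (induction j)
  case 0
  then show ?case by simp
next
  case (Suc j)
  have "2 * pi * real \<nu> / real k / 2 = real \<nu> * pi / real k"
    by simp
  then have "(cmod (cis (2 * pi * real \<nu> / real k) - 1))\<^sup>2 = 4 * (sin (real \<nu> * pi / real k))\<^sup>2"
    by (simp only: norm_cis_minus_one_power2)
  with Suc.IH show ?case
    using assms by (simp add: fourier_coeff_cyc_diff norm_mult power_mult_distrib mult_ac)
qed

lemma sum_coeff_mult_norm_derivatives:
  assumes "k > 0"
  shows "(\<Sum>j\<le>degree p. coeff p j * (herm_norm k ((cyc_diff k ^^ j) z))\<^sup>2)
    = real k * (\<Sum>\<nu><k. poly p (4 * (sin (real \<nu> * pi / real k))\<^sup>2) * (cmod (fourier_coeff k z \<nu>))\<^sup>2)"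
proof -
  have "(\<Sum>j\<le>degree p. coeff p j * (herm_norm k ((cyc_diff k ^^ j) z))\<^sup>2)
    = (\<Sum>j\<le>degree p. \<Sum>\<nu><k. real k * (coeff p j * (4 * (sin (real \<nu> * pi / real k))\<^sup>2) ^ j
        * (cmod (fourier_coeff k z \<nu>))\<^sup>2))"
    using assms
    by (simp add: parseval norm_fourier_coeff_derivative sum_distrib_left mult_ac)
  also have "\<dots> = (\<Sum>\<nu><k. \<Sum>j\<le>degree p. real k * (coeff p j * (4 * (sin (real \<nu> * pi / real k))\<^sup>2) ^ j
        * (cmod (fourier_coeff k z \<nu>))\<^sup>2))"
    by (rule sum.swap)
  finally show ?thesis
    by (simp only: poly_altdef sum_distrib_left sum_distrib_right)
qed

lemma degree_Q_poly: "degree (Q_poly k m) = m"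
  by (simp add: Q_poly_def degree_prod_eq_sum_degree)

lemma poly_Q_poly_pos:
  assumes "m < \<nu>" "\<nu> < k - m"
  shows "0 < poly (Q_poly k m) (4 * (sin (real \<nu> * pi / real k))\<^sup>2)"
  unfolding poly_Q_poly
proof (rule prod_pos)
  fix j assume "j \<in> {1..m}"
  then have j: "j < \<nu>" "\<nu> + j < k" using assms by auto
  have "real \<nu> * pi / real k + real j * pi / real k = real (\<nu> + j) * pi / real k"
    by (simp add: add_divide_distrib distrib_right)
  moreover have "real \<nu> * pi / real k - real j * pi / real k = real (\<nu> - j) * pi / real k"
    using j by (simp add: of_nat_diff diff_divide_distrib left_diff_distrib)
  ultimately have "(sin (real \<nu> * pi / real k))\<^sup>2 - (sin (real j * pi / real k))\<^sup>2
      = sin (real (\<nu> + j) * pi / real k) * sin (real (\<nu> - j) * pi / real k)"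
    by (simp only: sin_power2_diff)
  also have "\<dots> > 0"
    using j by (intro mult_pos_pos sin_pi_fraction_pos) auto
  finally show "0 < 4 * (sin (real \<nu> * pi / real k))\<^sup>2 - 4 * (sin (real j * pi / real k))\<^sup>2"
    by simp
qed

lemma poly_Q_poly_eq_0:
  assumes "0 < \<nu>" "\<nu> < k" "\<nu> \<le> m \<or> k - m \<le> \<nu>"
  shows "poly (Q_poly k m) (4 * (sin (real \<nu> * pi / real k))\<^sup>2) = 0"
proof -
  have "\<exists>j\<in>{1..m}. sin (real j * pi / real k) = sin (real \<nu> * pi / real k)"
  proof (cases "\<nu> \<le> m")
    case True
    then show ?thesis using assms by (intro bexI[of _ \<nu>]) auto
  next
    case False
    have "real (k - \<nu>) * pi / real k = pi - real \<nu> * pi / real k"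
      using assms by (simp add: of_nat_diff field_simps)
    then have "sin (real (k - \<nu>) * pi / real k) = sin (real \<nu> * pi / real k)"
      by (simp only: sin_pi_minus)
    then show ?thesis using assms False by (intro bexI[of _ "k - \<nu>"]) auto
  qed
  then obtain j where "j \<in> {1..m}" "sin (real j * pi / real k) = sin (real \<nu> * pi / real k)"
    by blast
  then show ?thesis
    unfolding poly_Q_poly by (intro prod_zero bexI[of _ j]) simp_all
qed

theorem proposition1:
  fixes k m :: nat and z :: "nat \<Rightarrow> complex"
  assumes "1 \<le> m" and "m \<le> k div 2"
    and "(\<Sum>\<nu><k. z \<nu>) = 0"
  shows "(\<Sum>j=0..m. coeff (Q_poly k m) j * (herm_norm k ((cyc_diff k ^^ j) z))\<^sup>2) \<ge> 0
    \<and> ((\<Sum>j=0..m. coeff (Q_poly k m) j * (herm_norm k ((cyc_diff k ^^ j) z))\<^sup>2) = 0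
         \<longleftrightarrow> (\<forall>\<nu>. m < \<nu> \<and> \<nu> < k - m \<longrightarrow> fourier_coeff k z \<nu> = 0))"
proof -
  define T where "T \<nu> = poly (Q_poly k m) (4 * (sin (real \<nu> * pi / real k))\<^sup>2)
    * (cmod (fourier_coeff k z \<nu>))\<^sup>2" for \<nu>
  have "k > 0" using assms by auto
  have form: "(\<Sum>j=0..m. coeff (Q_poly k m) j * (herm_norm k ((cyc_diff k ^^ j) z))\<^sup>2)
      = real k * (\<Sum>\<nu><k. T \<nu>)"
    using sum_coeff_mult_norm_derivatives[OF \<open>k > 0\<close>, of "Q_poly k m" z]
    by (simp add: degree_Q_poly T_def atMost_atLeast0)
  have middle: "T \<nu> \<ge> 0" "T \<nu> = 0 \<longleftrightarrow> fourier_coeff k z \<nu> = 0" if "m < \<nu> \<and> \<nu> < k - m" for \<nu>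
    using poly_Q_poly_pos[of m \<nu> k] that by (simp_all add: T_def)
  have outer: "T \<nu> = 0" if "\<nu> < k" "\<not> (m < \<nu> \<and> \<nu> < k - m)" for \<nu>
  proof (cases "\<nu> = 0")
    case True
    have "fourier_coeff k z 0 = 0"
      using assms(3) by (simp add: fourier_coeff_def)
    with True show ?thesis by (simp add: T_def)
  next
    case False
    then show ?thesis
      using poly_Q_poly_eq_0[of \<nu> k m] that by (simp add: T_def not_less)
  qed
  have nonneg: "T \<nu> \<ge> 0" if "\<nu> < k" for \<nu>
    using middle(1) outer that by (metis order_refl)
  then have "(\<Sum>\<nu><k. T \<nu>) = 0 \<longleftrightarrow> (\<forall>\<nu><k. T \<nu> = 0)"
    by (subst sum_nonneg_eq_0_iff) auto
  also have "\<dots> \<longleftrightarrow> (\<forall>\<nu>. m < \<nu> \<and> \<nu> < k - m \<longrightarrow> fourier_coeff k z \<nu> = 0)"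
    using middle(2) outer by (meson diff_le_self less_le_trans)
  finally show ?thesis
    unfolding form using \<open>k > 0\<close> nonneg by (auto intro!: mult_nonneg_nonneg sum_nonneg)
qed

end
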